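(* Let $\boldsymbol d$ be a degree sequence on $W$, let $L_0,Y\subseteq K_n$ with $L_0\cap Y=\boldsymbol{\emptyset}$, choose vertices $p_1,\dots,p_{m(Y)},q_1,\dots,q_{m(Y)}\in W$ such that $\bar e_j=p_jq_j$ and $\{\bar e_j\}_{j=1}^{m(Y)}$ enumerates the edges of $Y$, and set $L_j=L_0+\bar e_1+\dots+\bar e_j$. Let $G\sim\mathcal G_{\boldsymbol d}(\boldsymbol{\emptyset},L_0)$. (A) If $g(\boldsymbol d,\boldsymbol{\emptyset},L_{j-1},\bar e_j)>0$ for all $j$, then $$\mathbb P(Y\cap G=\boldsymbol{\emptyset})\le\prod_{j=1}^{m(Y)}\left(1+\frac{d_{p_j}d_{q_j}}{2m(G)}\right)^{-1}\cdot\prod_{j=1}^{m(Y)}\frac{1}{g(\boldsymbol d,\boldsymbol{\emptyset},L_{j-1},\bar e_j)}.$$ (B) If $f(\boldsymbol d,\boldsymbol{\emptyset},L_{j-1},\bar e_j)>0$ for all $j$, then $$\mathbb P(Y\cap G=\boldsymbol{\emptyset})\ge\prod_{j=1}^{m(Y)}\left(1+\frac{d_{p_j}d_{q_j}}{2m(G)}\right)^{-1}\cdot\prod_{j=1}^{m(Y)}f(\boldsymbol d,\boldsymbol{\emptyset},L_{j-1},\bar e_j).$$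
   Context: $K_n$ is the complete graph on $W=\{w_1,\dots,w_n\}$; graphs are subgraphs of $K_n$ on $W$, identified with edge sets; $\boldsymbol{\emptyset}$ is the edgeless graph. For a graph $H$ (resp. $L$), $\boldsymbol h$ (resp. $\boldsymbol l$) is its degree sequence and $m(H)$ its number of edges; $H+uv$ is $H$ with edge $uv$ added. $\mathcal G_{\boldsymbol d}(X,Y)$ is the (assumed nonempty) set of $G\subseteq K_n$ with degree sequence $\boldsymbol d$, $X\subseteq G$, $G\cap Y=\boldsymbol{\emptyset}$, with uniform distribution. $m(G):=\frac12\sum_w d_w$. Degree sum function: for a nonnegative integer vector $\boldsymbol g$ indexed by a finite set $W'$ with entries $g_{i_1}\ge\dots\ge g_{i_N}$ in nonincreasing order, $L(\boldsymbol g,k)=\sum_{j\le k}g_{i_j}$, $D(\boldsymbol g,x)=g_{i_1}x$ for $x<1$, $=g_{i_{k+1}}(x-k)+L(\boldsymbol g,k)$ for $x\in[k,k+1)$, $1\le k\le N-1$, $=L(\boldsymbol g,N)$ for $x\ge N$. $D_H(x)=D(\boldsymbol d-\boldsymbol h,x)$. $\alpha_w(\boldsymbol n,\boldsymbol l,\boldsymbol g,\boldsymbol h)=D(\boldsymbol n+\boldsymbol l,\max\{g_w-h_w,1\})/\max\{g_w-h_w,1\}$. For $H\cap L=\boldsymbol{\emptyset}$, $uv\notin H\cup L$, $\boldsymbol l$ the degree sequence of $L$: $f(\boldsymbol d,H,L,uv)=1-\dfrac{D_H(d_u+l_u)+D_H(d_v+l_v)}{2m(G)-2m(H)}$, $g(\boldsymbol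 d,H,L,uv)=1-\dfrac{D_H(\alpha_u(\boldsymbol d,\boldsymbol l,\boldsymbol d,\boldsymbol h)+2)+D_H(\alpha_v(\boldsymbol d,\boldsymbol l,\boldsymbol d,\boldsymbol h)+2)}{2m(G)-2m(H)}$ (with $H=\boldsymbol\emptyset$, $\boldsymbol h=\mathbf 0$ here). *)

theory Defs
  imports "HOL-Probability.Probability"
begin

text \<open>A simple graph on the vertex set \<open>W\<close> is identified with its edge set, a set of two-element
  subsets of \<open>W\<close>. Functions on vertices matter only through their values on \<open>W\<close>.\<close>

definition complete_graph_on :: "'a set \<Rightarrow> 'a set set" where
  "complete_graph_on W = {e. e \<subseteq> W \<and> card e = 2}"

definition graph_deg :: "'a set set \<Rightarrow> 'a \<Rightarrow> nat" where
  "graph_deg H w = card {e \<in> H. w \<in> e}"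

definition graphs_avoiding ::
    "'a set \<Rightarrow> ('a \<Rightarrow> nat) \<Rightarrow> 'a set set \<Rightarrow> 'a set set \<Rightarrow> 'a set set set" where
  "graphs_avoiding W d X Y =
     {G. G \<subseteq> complete_graph_on W \<and> (\<forall>w\<in>W. graph_deg G w = d w) \<and> X \<subseteq> G \<and> G \<inter> Y = {}}"

definition edge_count :: "'a set \<Rightarrow> ('a \<Rightarrow> nat) \<Rightarrow> real" where
  "edge_count W d = (\<Sum>w\<in>W. real (d w)) / 2"

definition noninc_entries :: "'a set \<Rightarrow> ('a \<Rightarrow> nat) \<Rightarrow> nat list" where
  "noninc_entries W g = rev (sorted_list_of_multiset (image_mset g (mset_set W)))"

definition top_sum :: "'a set \<Rightarrow> ('a \<Rightarrow> nat) \<Rightarrow> nat \<Rightarrow> nat" where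
  "top_sum W g k = sum_list (take k (noninc_entries W g))"

text \<open>The list of entries is indexed from \<open>0\<close>, so its entry number \<open>k\<close> is the \<open>(k+1)\<close>-st largest
  value of \<open>g\<close>.\<close>

definition degree_sum :: "'a set \<Rightarrow> ('a \<Rightarrow> nat) \<Rightarrow> real \<Rightarrow> real" where
  "degree_sum W g x =
     (if x < 1 then real (noninc_entries W g ! 0) * x
      else if x < real (card W) then
        (let k = nat \<lfloor>x\<rfloor>
         in real (noninc_entries W g ! k) * (x - real k) + real (top_sum W g k))
      else real (top_sum W g (card W)))"

text \<open>Intended for graphs \<open>H\<close> whose degrees are bounded by \<open>d\<close>, so that the subtraction of natural
  numbers is not truncated.\<close>

definition residual_degree_sum ::
    "'a set \<Rightarrow> ('a \<Rightarrow> nat) \<Rightarrow> 'a set set \<Rightarrow> real \<Rightarrow> real" where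
  "residual_degree_sum W d H = degree_sum W (\<lambda>w. d w - graph_deg H w)"

definition alpha ::
    "'a set \<Rightarrow> ('a \<Rightarrow> nat) \<Rightarrow> ('a \<Rightarrow> nat) \<Rightarrow> ('a \<Rightarrow> nat) \<Rightarrow> ('a \<Rightarrow> nat) \<Rightarrow> 'a \<Rightarrow> real" where
  "alpha W n l g h w =
     degree_sum W (\<lambda>v. n v + l v) (max (real (g w) - real (h w)) 1)
       / max (real (g w) - real (h w)) 1"

definition f_bound ::
    "'a set \<Rightarrow> ('a \<Rightarrow> nat) \<Rightarrow> 'a set set \<Rightarrow> 'a set set \<Rightarrow> 'a \<Rightarrow> 'a \<Rightarrow> real" where
  "f_bound W d H L u v =
     1 - (residual_degree_sum W d H (real (d u) + real (graph_deg L u))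
          + residual_degree_sum W d H (real (d v) + real (graph_deg L v)))
         / (2 * edge_count W d - 2 * real (card H))"

definition g_bound ::
    "'a set \<Rightarrow> ('a \<Rightarrow> nat) \<Rightarrow> 'a set set \<Rightarrow> 'a set set \<Rightarrow> 'a \<Rightarrow> 'a \<Rightarrow> real" where
  "g_bound W d H L u v =
     1 - (residual_degree_sum W d H (alpha W d (graph_deg L) d (graph_deg H) u + 2)
          + residual_degree_sum W d H (alpha W d (graph_deg L) d (graph_deg H) v + 2))
         / (2 * edge_count W d - 2 * real (card H))"

end

theory Submission
  imports Defs
begin

text \<open>Adding the edges \<open>uv\<close> of \<open>Y\<close> one at a time to the forbidden graph \<open>L\<close>, it suffices to compare the
  number of graphs through \<open>uv\<close> with the number of graphs avoiding \<open>uv\<close>. Replacing \<open>uv, xy\<close> by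
  \<open>ux, vy\<close> bounds the former from above, which gives (B); replacing \<open>ux, vy, ab\<close> by \<open>uv, xa, yb\<close>
  bounds it from below, which gives (A). In (A) the number of forbidden arcs \<open>ab\<close> depends on the
  degrees of \<open>x\<close> and \<open>y\<close>; averaging over the neighbours of \<open>u\<close> and \<open>v\<close> leads to \<open>\<alpha>\<close>, because the degree
  sum function is concave.\<close>

section \<open>The degree sum function\<close>

text \<open>Entries before position \<open>k\<close> are at least \<open>xs ! k\<close> and those
  from \<open>k\<close> on at most \<open>xs ! k\<close>, so truncation at 0 keeps exactly the first
  \<open>k\<close> differences. This evaluates the dual bound at the threshold
  \<open>c = xs ! k\<close>.\<close>

lemma sum_list_excess_sorted:
  fixes xs :: "nat list"
  assumes "sorted (rev xs)" "k < length xs"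
  shows "(\<Sum>z\<leftarrow>xs. max (real z - real (xs ! k)) 0) = real (sum_list (take k xs)) - real k * real (xs ! k)"
proof -
  let ?c = "xs ! k"
  have mono: "xs ! j \<le> xs ! i" if "i \<le> j" "j < length xs" for i j
    using sorted_rev_nth_mono[OF assms(1)] that by blast
  have A: "(\<Sum>z\<leftarrow>take k xs. max (real z - real ?c) 0) = (\<Sum>z\<leftarrow>take k xs. real z - real ?c)"
  proof (rule arg_cong[where f = sum_list], rule map_cong[OF refl])
    fix z assume "z \<in> set (take k xs)"
    then obtain i where "i < k" "z = xs ! i" by (auto simp: in_set_conv_nth)
    then show "max (real z - real ?c) 0 = real z - real ?c" using mono[of i k] assms(2) by auto
  qed
  have B: "(\<Sum>z\<leftarrow>drop k xs. max (real z - real ?c) 0) = 0"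
  proof -
    have "max (real z - real ?c) 0 = 0" if "z \<in> set (drop k xs)" for z
    proof -
      from that obtain i where "i < length xs - k" "z = xs ! (k + i)" by (auto simp: in_set_conv_nth)
      then show ?thesis using mono[of k "k + i"] by auto
    qed
    then have "map (\<lambda>z. max (real z - real ?c) 0) (drop k xs) = map (\<lambda>z. 0) (drop k xs)"
      by (rule map_cong[OF refl])
    then show ?thesis by (simp only: sum_list_0)
  qed
  have C: "(\<Sum>z\<leftarrow>ys. real z - r) = real (sum_list ys) - real (length ys) * r" for ys :: "nat list" and r
    by (induction ys) (auto simp: algebra_simps)
  have "(\<Sum>z\<leftarrow>xs. max (real z - real ?c) 0)
      = (\<Sum>z\<leftarrow>take k xs @ drop k xs. max (real z - real ?c) 0)" by simp
  also have "\<dots> = (\<Sum>z\<leftarrow>take k xs. real z - real ?c)"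
    unfolding map_append sum_list_append A B by simp
  finally show ?thesis using assms(2) by (simp add: C)
qed

lemma sum_list_noninc_entries:
  fixes h :: "nat \<Rightarrow> 'b :: comm_monoid_add"
  shows "(\<Sum>z\<leftarrow>noninc_entries W g. h z) = (\<Sum>w\<in>W. h (g w))"
proof -
  have "(\<Sum>z\<leftarrow>noninc_entries W g. h z) = sum_mset (image_mset h (mset (noninc_entries W g)))"
    by (metis mset_map sum_mset_sum_list)
  also have "\<dots> = (\<Sum>w\<in>W. h (g w))"
    by (simp add: noninc_entries_def sum_unfold_sum_mset image_mset.compositionality comp_def)
  finally show ?thesis .
qed

lemma length_noninc_entries: "length (noninc_entries W g) = card W"
proof -
  have "length (noninc_entries W g) = size (mset (noninc_entries W g))" by simp
  also have "\<dots> = card W" by (simp add: noninc_entries_def)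
  finally show ?thesis .
qed

text \<open>Linear programming duality for the sum of the \<open>t\<close> largest entries: the value is attained by the
  affine function \<open>t \<mapsto> c t + (\<Sum>w\<in>W. max (g w - c) 0)\<close>, and every such function with \<open>c \<ge> 0\<close> is an
  upper bound. This replaces concavity and monotonicity of the degree sum function.\<close>

lemma degree_sum_dual:
  assumes "finite W" "W \<noteq> {}" "0 \<le> t"
  obtains c where "0 \<le> c" "degree_sum W g t = c * t + (\<Sum>w\<in>W. max (real (g w) - c) 0)"
proof -
  let ?xs = "noninc_entries W g"
  have len: "length ?xs = card W" by (rule length_noninc_entries)
  have srt: "sorted (rev ?xs)" by (simp add: noninc_entries_def)
  have N: "card W > 0" using assms by (simp add: card_gt_0_iff)
  have aux: "(\<Sum>w\<in>W. max (real (g w) - real (?xs ! k)) 0)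
      = real (top_sum W g k) - real k * real (?xs ! k)" if "k < card W" for k
    using sum_list_excess_sorted[OF srt, of k] that
      sum_list_noninc_entries[where h = "\<lambda>z. max (real z - real (?xs ! k)) 0" and W = W and g = g]
    by (simp add: len top_sum_def)
  consider "t < 1" | "1 \<le> t" "t < card W" | "1 \<le> t" "t \<ge> card W" by linarith
  then show thesis
  proof cases
    case 1
    \<comment> \<open>The slope is the largest entry; nothing exceeds it, so the constant term is
      0.\<close>
    show thesis
      by (rule that[of "real (?xs ! 0)"])
        (use aux[of 0] N 1 in \<open>simp_all add: degree_sum_def top_sum_def\<close>)
  next
    case 2
    \<comment> \<open>On [k, k+1) the slope is entry number \<open>k\<close>, counted from 0;
      \<open>c * t\<close> plus the excess over it is
      \<open>c * (t - k) + top_sum W g k\<close>.\<close>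
    define k where "k = nat \<lfloor>t\<rfloor>"
    have "k < card W" using 2 assms(3) by (auto simp: k_def nat_less_iff floor_less_iff)
    from aux[OF this] show thesis
      by (intro that[of "real (?xs ! k)"])
        (use 2 in \<open>simp_all add: degree_sum_def k_def[symmetric] Let_def algebra_simps\<close>)
  next
    case 3
    \<comment> \<open>From \<open>card W\<close> on the function is constant, so
      \<open>c = 0\<close>, and the excess over 0 is the whole sum.\<close>
    have "real (top_sum W g (card W)) = (\<Sum>w\<in>W. real (g w))"
      using sum_list_noninc_entries[where h = "\<lambda>z. z" and W = W and g = g] len
      by (simp add: top_sum_def)
    then show thesis
      by (intro that[of 0]) (use 3 in \<open>simp_all add: degree_sum_def\<close>)
  qed
qed

lemma degree_sum_nonneg:
  assumes "finite W" "W \<noteq> {}" "0 \<le> t"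
  shows "0 \<le> degree_sum W g t"
proof -
  obtain c where "0 \<le> c" "degree_sum W g t = c * t + (\<Sum>w\<in>W. max (real (g w) - c) 0)"
    using degree_sum_dual[OF assms] .
  then show ?thesis using assms(3) by (simp add: sum_nonneg)
qed

text \<open>A form of Jensen's inequality: the threshold \<open>c\<close> that is optimal for the
  average size \<open>t\<close> serves all sets at once, and the resulting bound is affine in the
  size of \<open>A i\<close>, so only the average size matters.\<close>

lemma sum_family_le_degree_sum:
  assumes "finite W" "W \<noteq> {}" "0 \<le> t"
    and sub: "\<And>i. i \<in> I \<Longrightarrow> A i \<subseteq> W"
    and avg: "(\<Sum>i\<in>I. real (card (A i))) \<le> real (card I) * t"
  shows "(\<Sum>i\<in>I. \<Sum>x\<in>A i. real (g x)) \<le> real (card I) * degree_sum W g t"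
proof -
  obtain c where c: "0 \<le> c"
    and D: "degree_sum W g t = c * t + (\<Sum>w\<in>W. max (real (g w) - c) 0)" (is "_ = _ + ?R")
    using degree_sum_dual[OF assms(1-3)] .
  have "(\<Sum>x\<in>A i. real (g x)) \<le> c * real (card (A i)) + ?R" if "i \<in> I" for i
  proof -
    have "(\<Sum>x\<in>A i. real (g x)) \<le> (\<Sum>x\<in>A i. c + max (real (g x) - c) 0)"
      by (rule sum_mono) auto
    also have "\<dots> = c * real (card (A i)) + (\<Sum>x\<in>A i. max (real (g x) - c) 0)"
      by (simp add: sum.distrib)
    \<comment> \<open>Enlarging \<open>A i\<close> to \<open>W\<close> adds only nonnegative excess
      and makes the constant independent of \<open>i\<close>.\<close>
    also have "(\<Sum>x\<in>A i. max (real (g x) - c) 0) \<le> ?R"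
      using assms(1) sub[OF that] by (intro sum_mono2) auto
    finally show ?thesis by simp
  qed
  then have "(\<Sum>i\<in>I. \<Sum>x\<in>A i. real (g x)) \<le> (\<Sum>i\<in>I. c * real (card (A i)) + ?R)"
    by (rule sum_mono)
  also have "\<dots> = c * (\<Sum>i\<in>I. real (card (A i))) + real (card I) * ?R"
    by (simp add: sum.distrib sum_distrib_left)
  \<comment> \<open>The average size may lie below \<open>t\<close>; a nonnegative slope makes this
    harmless.\<close>
  also have "\<dots> \<le> c * (real (card I) * t) + real (card I) * ?R"
    using mult_left_mono[OF avg c] by simp
  finally show ?thesis by (simp add: D algebra_simps)
qed

lemma sum_le_degree_sum:
  assumes "finite W" "W \<noteq> {}" "A \<subseteq> W" "real (card A) \<le> t"
  shows "(\<Sum>x\<in>A. real (g x)) \<le> degree_sum W g t"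
  using sum_family_le_degree_sum[of W t "{()}" "\<lambda>_. A" g] assms by simp

section \<open>Neighbours, arcs and switchings\<close>

definition nbrs :: "'a set set \<Rightarrow> 'a \<Rightarrow> 'a set" where
  "nbrs G u = {x. {u, x} \<in> G}"

text \<open>Each edge gives two arcs, so their number is 2m(G), which is where the denominators come
  from. The orientation tells a switching which end of an edge is joined to which vertex.\<close>

definition arcs :: "'a set set \<Rightarrow> ('a \<times> 'a) set" where
  "arcs G = {(x, y). {x, y} \<in> G}"

lemma finite_complete_graph_on: "finite W \<Longrightarrow> finite (complete_graph_on W)"
  by (rule finite_subset[of _ "Pow W"]) (auto simp: complete_graph_on_def)

lemma edge_complete_graph_on: "{x, y} \<in> complete_graph_on W \<longleftrightarrow> x \<in> W \<and> y \<in> W \<and> x \<noteq> y"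
  by (auto simp: complete_graph_on_def card_insert_if)

lemma nbrs_subset: "G \<subseteq> complete_graph_on W \<Longrightarrow> nbrs G u \<subseteq> W"
  using edge_complete_graph_on unfolding nbrs_def by fastforce

lemma not_in_nbrs_self: "G \<subseteq> complete_graph_on W \<Longrightarrow> u \<notin> nbrs G u"
  using edge_complete_graph_on[of u u W] unfolding nbrs_def by auto

lemma card_nbrs:
  assumes "G \<subseteq> complete_graph_on W"
  shows "card (nbrs G u) = graph_deg G u"
proof -
  have "bij_betw (\<lambda>x. {u, x}) (nbrs G u) {e \<in> G. u \<in> e}"
    unfolding bij_betw_def
  proof
    show "inj_on (\<lambda>x. {u, x}) (nbrs G u)"
      by (auto simp: inj_on_def doubleton_eq_iff)
    show "(\<lambda>x. {u, x}) ` nbrs G u = {e \<in> G. u \<in> e}"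
    proof
      show "{e \<in> G. u \<in> e} \<subseteq> (\<lambda>x. {u, x}) ` nbrs G u"
      proof
        fix e assume e: "e \<in> {e \<in> G. u \<in> e}"
        then have "card e = 2" using assms by (auto simp: complete_graph_on_def)
        then obtain a b where "e = {a, b}" by (auto simp: card_2_iff)
        then have "e = {u, if u = a then b else a}" using e by auto
        then show "e \<in> (\<lambda>x. {u, x}) ` nbrs G u" using e unfolding nbrs_def by auto
      qed
    qed (auto simp: nbrs_def)
  qed
  then show ?thesis unfolding graph_deg_def by (rule bij_betw_same_card)
qed

lemma arcs_swap: "(x, y) \<in> arcs G \<longleftrightarrow> (y, x) \<in> arcs G"
  by (simp add: arcs_def insert_commute)

lemma finite_arcs:
  assumes "finite W" "G \<subseteq> complete_graph_on W"
  shows "finite (arcs G)"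
proof (rule finite_subset)
  show "arcs G \<subseteq> W \<times> W" using assms(2) edge_complete_graph_on unfolding arcs_def by fastforce
qed (use assms(1) in simp)

lemma card_arcs_from:
  assumes "finite W" "G \<subseteq> complete_graph_on W" "A \<subseteq> W"
  shows "card {(x, y) \<in> arcs G. x \<in> A} = (\<Sum>x\<in>A. graph_deg G x)"
proof -
  have "{(x, y) \<in> arcs G. x \<in> A} = (SIGMA x:A. nbrs G x)"
    by (auto simp: arcs_def nbrs_def)
  moreover have "finite A" using assms finite_subset by blast
  moreover have "finite (nbrs G x)" for x using nbrs_subset[OF assms(2)] assms(1) finite_subset by blast
  ultimately show ?thesis by (simp add: card_nbrs[OF assms(2)])
qed

lemma card_arcs_to:
  assumes "finite W" "G \<subseteq> complete_graph_on W" "A \<subseteq> W"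
  shows "card {(x, y) \<in> arcs G. y \<in> A} = (\<Sum>x\<in>A. graph_deg G x)"
proof -
  have "{(x, y) \<in> arcs G. y \<in> A} = prod.swap ` {(x, y) \<in> arcs G. x \<in> A}"
    by (force simp: arcs_swap image_iff)
  then show ?thesis using card_arcs_from[OF assms] by (simp add: card_image)
qed

lemma card_arcs:
  assumes "finite W" "G \<subseteq> complete_graph_on W"
  shows "card (arcs G) = (\<Sum>x\<in>W. graph_deg G x)"
proof -
  have "{(x, y) \<in> arcs G. x \<in> W} = arcs G"
    using assms(2) edge_complete_graph_on unfolding arcs_def by fastforce
  then show ?thesis using card_arcs_from[OF assms, of W] by simp
qed

section \<open>Degrees under the exchange of edge sets\<close>

lemma graph_deg_empty [simp]: "graph_deg {} w = 0"
  by (simp add: graph_deg_def)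

lemma graph_deg_insert:
  assumes "finite H" "e \<notin> H"
  shows "graph_deg (insert e H) w = of_bool (w \<in> e) + graph_deg H w"
proof -
  have "{e' \<in> insert e H. w \<in> e'} = (if w \<in> e then insert e {e' \<in> H. w \<in> e'} else {e' \<in> H. w \<in> e'})"
    by auto
  then show ?thesis using assms by (simp add: graph_deg_def)
qed

lemma graph_deg_Un:
  assumes "finite A" "finite B" "A \<inter> B = {}"
  shows "graph_deg (A \<union> B) w = graph_deg A w + graph_deg B w"
proof -
  have "{e \<in> A \<union> B. w \<in> e} = {e \<in> A. w \<in> e} \<union> {e \<in> B. w \<in> e}" by auto
  then show ?thesis using assms unfolding graph_deg_def by (auto intro!: card_Un_disjoint)
qed

text \<open>Splits the contribution of an edge to the degrees over its two ends. Equality of degrees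
  before and after a switching then becomes a rearrangement of indicators.\<close>

lemma of_bool_mem_edge:
  "a \<noteq> b \<Longrightarrow> of_bool (w \<in> {a, b}) = (of_bool (w = a) + of_bool (w = b) :: nat)"
  by auto

text \<open>\<open>R\<close> lies inside \<open>G\<close> and \<open>E\<close> outside it, so both
  degree sequences are removed and added exactly, and they cancel. Both kinds of switching are
  instances.\<close>

lemma switch_graphs_avoiding:
  assumes "finite W" "G \<in> graphs_avoiding W d {} L" "R \<subseteq> G"
    and "E \<subseteq> complete_graph_on W" "E \<inter> (G \<union> L) = {}"
    and "\<And>w. graph_deg R w = graph_deg E w"
  shows "(G - R) \<union> E \<in> graphs_avoiding W d {} L"
proof -
  have sub: "G \<subseteq> complete_graph_on W" using assms(2) by (auto simp: graphs_avoiding_def)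
  have fin: "finite G" "finite E"
    using finite_complete_graph_on[OF assms(1)] sub assms(4) finite_subset by blast+
  have "graph_deg ((G - R) \<union> E) w = graph_deg G w" for w
  proof -
    have "graph_deg ((G - R) \<union> E) w = graph_deg (G - R) w + graph_deg R w"
      using graph_deg_Un[of "G - R" E w] fin assms(5,6) by auto
    also have "\<dots> = graph_deg ((G - R) \<union> R) w"
      using graph_deg_Un[of "G - R" R w] fin assms(3) finite_subset by fastforce
    also have "(G - R) \<union> R = G" using assms(3) by blast
    finally show ?thesis .
  qed
  then show ?thesis using assms sub by (auto simp: graphs_avoiding_def)
qed

text \<open>Deleting \<open>E\<close> and restoring \<open>R\<close> recovers the graph. A switching
  map is therefore injective as soon as its value records the vertices that determine
  \<open>R\<close> and \<open>E\<close>.\<close>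

lemma switch_inject:
  assumes "(G - R) \<union> E = (G' - R) \<union> E" "R \<subseteq> G" "R \<subseteq> G'" "E \<inter> G = {}" "E \<inter> G' = {}"
  shows "G = G'"
  using assms by blast

lemma graphs_avoiding_empty_iff:
  "G \<in> graphs_avoiding W d {} L \<longleftrightarrow>
     G \<subseteq> complete_graph_on W \<and> (\<forall>w\<in>W. graph_deg G w = d w) \<and> G \<inter> L = {}"
  by (auto simp: graphs_avoiding_def)

lemma finite_graphs_avoiding: "finite W \<Longrightarrow> finite (graphs_avoiding W d X L)"
  by (rule finite_subset[of _ "Pow (complete_graph_on W)"])
    (auto simp: graphs_avoiding_def finite_complete_graph_on)

text \<open>\<open>G\<close> avoids \<open>L\<close>, so the degrees add up. This is the origin of
  the arguments \<open>d u + l u\<close> in \<open>f_bound\<close> and of the vector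
  \<open>d + l\<close> in \<open>alpha\<close>.\<close>

lemma card_nbrs_Un:
  assumes "finite W" "L \<subseteq> complete_graph_on W" "G \<in> graphs_avoiding W d {} L" "w \<in> W"
  shows "card (nbrs (G \<union> L) w) = d w + graph_deg L w"
proof -
  have G: "G \<subseteq> complete_graph_on W" "graph_deg G w = d w" "G \<inter> L = {}"
    using assms by (auto simp: graphs_avoiding_empty_iff)
  have "finite G" "finite L" using G(1) assms(1,2) finite_complete_graph_on finite_subset by blast+
  then show ?thesis using card_nbrs[of "G \<union> L" W w] graph_deg_Un[of G L w] G assms(2) by simp
qed

section \<open>Comparing the graphs through an edge with those avoiding it\<close>

text \<open>Each arc \<open>(u, y)\<close> or \<open>(x, v)\<close>, which would create a loop, is compensated by its reverse, which is
  counted twice: it starts at a neighbour of \<open>u\<close> and ends at a neighbour of \<open>v\<close>. This is why the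
  argument of the degree sum function in (B) is not increased by one.\<close>

lemma card_two_switch_arcs_ge:
  assumes W: "finite W" "L \<subseteq> complete_graph_on W" "u \<in> W" "v \<in> W"
    and G: "G \<in> graphs_avoiding W d {} L" "{u, v} \<in> G"
  shows "(\<Sum>w\<in>W. real (d w)) - degree_sum W d (real (d u) + real (graph_deg L u))
            - degree_sum W d (real (d v) + real (graph_deg L v))
       \<le> real (card {(x, y) \<in> arcs G. x \<noteq> u \<and> y \<noteq> v \<and> x \<notin> nbrs (G \<union> L) u \<and> y \<notin> nbrs (G \<union> L) v})"
proof -
  let ?N = "nbrs (G \<union> L)"
  let ?good = "{(x, y) \<in> arcs G. x \<noteq> u \<and> y \<noteq> v \<and> x \<notin> ?N u \<and> y \<notin> ?N v}"
  let ?A = "{(x, y) \<in> arcs G. x \<in> ?N u}"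
  let ?B = "{(x, y) \<in> arcs G. y \<in> ?N v}"
  let ?C = "{(x, y) \<in> arcs G. x = u \<or> y = v}"
  have sub: "G \<subseteq> complete_graph_on W" and deg: "\<And>w. w \<in> W \<Longrightarrow> graph_deg G w = d w"
    using G by (auto simp: graphs_avoiding_empty_iff)
  have NW: "?N w \<subseteq> W" for w using nbrs_subset[of "G \<union> L" W] sub W(2) by simp
  have fin: "finite (arcs G)" using finite_arcs[OF W(1) sub] .
  have finA: "finite ?A" "finite ?B" "finite ?C" "finite ?good"
    by (rule finite_subset[OF _ fin]; auto)+
  \<comment> \<open>By \<open>{u, v} \<in> G\<close> the vertices \<open>u\<close> and
    \<open>v\<close> are neighbours, so the reverse of an arc in \<open>?C\<close> lies in both
    \<open>?A\<close> and \<open>?B\<close>.\<close>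
  have "card ?C = card (prod.swap ` ?C)" by (simp add: card_image)
  also have "\<dots> \<le> card (?A \<inter> ?B)"
  proof (rule card_mono)
    show "finite (?A \<inter> ?B)" using finA by blast
    show "prod.swap ` ?C \<subseteq> ?A \<inter> ?B" using G(2) by (auto simp: nbrs_def arcs_def insert_commute)
  qed
  finally have C: "card ?C \<le> card (?A \<inter> ?B)" .
  have "card (arcs G) \<le> card (?good \<union> ((?A \<union> ?B) \<union> ?C))"
  proof (rule card_mono)
    show "finite (?good \<union> ((?A \<union> ?B) \<union> ?C))" using finA by blast
    show "arcs G \<subseteq> ?good \<union> ((?A \<union> ?B) \<union> ?C)" by blast
  qed
  also have "\<dots> \<le> card ?good + (card (?A \<union> ?B) + card ?C)"
    by (meson card_Un_le add_left_mono order_trans)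
  also have "\<dots> \<le> card ?good + (card ?A + card ?B)"
    using C card_Un_Int[OF finA(1,2)] by simp
  finally have le: "real (card (arcs G)) \<le> real (card ?good) + real (card ?A) + real (card ?B)"
    by linarith
  have tot: "real (card (arcs G)) = (\<Sum>w\<in>W. real (d w))"
    using card_arcs[OF W(1) sub] deg by simp
  have D: "(\<Sum>x\<in>?N w. real (graph_deg G x)) \<le> degree_sum W d (real (d w) + real (graph_deg L w))"
    if "w \<in> W" for w
  proof -
    have "(\<Sum>x\<in>?N w. real (graph_deg G x)) = (\<Sum>x\<in>?N w. real (d x))"
      using NW deg by (intro sum.cong) auto
    then show ?thesis
      using sum_le_degree_sum[OF W(1) _ NW, of w "real (d w) + real (graph_deg L w)" d]
        card_nbrs_Un[OF W(1,2) G(1) that] that by auto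
  qed
  show ?thesis
    using le tot D[OF W(3)] D[OF W(4)]
    unfolding card_arcs_from[OF W(1) sub NW] card_arcs_to[OF W(1) sub NW] of_nat_sum
    by linarith
qed

text \<open>Double counting of the switching from \<open>uv, xy\<close> to \<open>ux, vy\<close>.
  The factor on the left bounds the admissible arcs of each graph through \<open>uv\<close> from
  below; afterwards \<open>x\<close> and \<open>y\<close> are neighbours of \<open>u\<close> and
  \<open>v\<close>, with \<open>d u * d v\<close> choices in each graph avoiding
  \<open>uv\<close>.\<close>

lemma card_through_edge_upper:
  assumes W: "finite W" "L \<subseteq> complete_graph_on W" "u \<in> W" "v \<in> W" "u \<noteq> v" "{u, v} \<notin> L"
  shows "real (card {G \<in> graphs_avoiding W d {} L. {u, v} \<in> G})
           * ((\<Sum>w\<in>W. real (d w)) - degree_sum W d (real (d u) + real (graph_deg L u))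
                - degree_sum W d (real (d v) + real (graph_deg L v)))
       \<le> real (card (graphs_avoiding W d {} (insert {u, v} L))) * (real (d u) * real (d v))"
proof -
  let ?P = "{G \<in> graphs_avoiding W d {} L. {u, v} \<in> G}"
  let ?Q = "graphs_avoiding W d {} (insert {u, v} L)"
  let ?K = "(\<Sum>w\<in>W. real (d w)) - degree_sum W d (real (d u) + real (graph_deg L u))
                - degree_sum W d (real (d v) + real (graph_deg L v))"
  let ?good = "\<lambda>G. {(x, y) \<in> arcs G. x \<noteq> u \<and> y \<noteq> v \<and> x \<notin> nbrs (G \<union> L) u \<and> y \<notin> nbrs (G \<union> L) v}"
  let ?S = "SIGMA G:?P. ?good G"
  let ?T = "SIGMA G:?Q. nbrs G u \<times> nbrs G v"
  let ?R = "\<lambda>x y. {{u, v}, {x, y}}" and ?E = "\<lambda>x y. {{u, x}, {v, y}}"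
  let ?\<phi> = "\<lambda>(G, x, y). ((G - ?R x y) \<union> ?E x y, x, y)"
  have finP: "finite ?P" and finQ: "finite ?Q"
    using finite_graphs_avoiding[OF W(1)] by simp_all
  have sub: "G \<subseteq> complete_graph_on W" if "G \<in> graphs_avoiding W d {} L'" for G L'
    using that by (auto simp: graphs_avoiding_empty_iff)
  have fgood: "finite (?good G)" if "G \<in> ?P" for G
    by (rule finite_subset[OF _ finite_arcs[OF W(1) sub[of G L]]]) (use that in auto)
  have fN: "finite (nbrs G w)" if "G \<in> ?Q" for G w
    using nbrs_subset[OF sub[OF that]] W(1) finite_subset by blast
  have valid: "?R x y \<subseteq> G \<and> ?E x y \<subseteq> complete_graph_on W \<and> ?E x y \<inter> (G \<union> L) = {}
      \<and> {u, v} \<notin> ?E x y \<and> (\<forall>w. graph_deg (?R x y) w = graph_deg (?E x y) w)"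
    if "G \<in> ?P" "(x, y) \<in> ?good G" for G x y
  proof -
    have G: "G \<subseteq> complete_graph_on W" "{u, v} \<in> G" using that(1) sub by auto
    have xy: "{x, y} \<in> G" "x \<noteq> u" "y \<noteq> v" "{u, x} \<notin> G \<union> L" "{v, y} \<notin> G \<union> L"
      using that(2) by (auto simp: arcs_def nbrs_def)
    have xyW: "x \<in> W" "y \<in> W" "x \<noteq> y" using edge_complete_graph_on[of x y W] xy(1) G(1) by auto
    \<comment> \<open>Otherwise a new edge would be \<open>uv\<close>, which is already in
      \<open>G\<close>.\<close>
    have ne: "x \<noteq> v" "y \<noteq> u" using xy(4,5) G(2) by (auto simp: insert_commute)
    \<comment> \<open>The removed edges are distinct and so are the added ones; hence no degree
      contribution is lost. The third fact ensures that the result avoids \<open>uv\<close>.\<close>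
    have d1: "{u, v} \<notin> {{x, y}}" "{u, x} \<notin> {{v, y}}" "{u, v} \<notin> ?E x y"
      using ne xy W(5) by (auto simp: doubleton_eq_iff)
    have "graph_deg (?R x y) w = graph_deg (?E x y) w" for w
      using d1 ne xy(2,3) xyW W(5)
      by (simp add: graph_deg_insert of_bool_mem_edge del: insert_iff singleton_iff)
    then show ?thesis using d1 G xy xyW W by (auto simp: edge_complete_graph_on)
  qed
  have "inj_on ?\<phi> ?S"
  proof (rule inj_onI)
    fix z z' assume "z \<in> ?S" "z' \<in> ?S" and eq: "?\<phi> z = ?\<phi> z'"
    then obtain G G' x y where z: "z = (G, x, y)" "z' = (G', x, y)"
      and a: "G \<in> ?P" "(x, y) \<in> ?good G" and b: "G' \<in> ?P" "(x, y) \<in> ?good G'"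
      by (cases z, cases z') auto
    have eq: "(G - ?R x y) \<union> ?E x y = (G' - ?R x y) \<union> ?E x y" using eq z by simp
    have 1: "?R x y \<subseteq> G" "?E x y \<inter> G = {}" using valid[OF a] by auto
    have 2: "?R x y \<subseteq> G'" "?E x y \<inter> G' = {}" using valid[OF b] by auto
    show "z = z'" using switch_inject[OF eq 1(1) 2(1) 1(2) 2(2)] z by simp
  qed
  moreover have "?\<phi> ` ?S \<subseteq> ?T"
  proof (rule image_subsetI)
    fix z assume "z \<in> ?S"
    then obtain G x y where z: "z = (G, x, y)" "G \<in> ?P" "(x, y) \<in> ?good G" by (cases z) auto
    note v = valid[OF z(2,3)]
    have "(G - ?R x y) \<union> ?E x y \<in> graphs_avoiding W d {} L"
      using z(2) v by (intro switch_graphs_avoiding[OF W(1)]) auto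
    then have "(G - ?R x y) \<union> ?E x y \<in> ?Q" using v by (auto simp: graphs_avoiding_empty_iff)
    then show "?\<phi> z \<in> ?T" by (simp add: z(1) nbrs_def)
  qed
  moreover have "finite ?T" using finQ fN by (intro finite_SigmaI) auto
  ultimately have le: "card ?S \<le> card ?T" by (rule card_inj_on_le)
  have "card (nbrs G u \<times> nbrs G v) = d u * d v" if "G \<in> ?Q" for G
    using card_nbrs[OF sub[OF that]] that W(3,4) by (simp add: card_cartesian_product graphs_avoiding_empty_iff)
  then have T: "card ?T = card ?Q * (d u * d v)"
    using finQ fN by (subst card_SigmaI) auto
  have "real (card ?P) * ?K = (\<Sum>G\<in>?P. ?K)" by simp
  also have "\<dots> \<le> (\<Sum>G\<in>?P. real (card (?good G)))"
    using card_two_switch_arcs_ge[OF W(1-4)] by (intro sum_mono) auto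
  also have "\<dots> = real (card ?S)" using finP fgood by (subst card_SigmaI) auto
  also have "\<dots> \<le> real (card ?Q * (d u * d v))" unfolding of_nat_le_iff using le T by linarith
  finally show ?thesis by simp
qed

section \<open>Three-edge switchings and averaging over neighbours\<close>

lemma card_three_switch_arcs_ge:
  assumes W: "finite W" and G: "G \<in> graphs_avoiding W d {} L" and X: "X \<subseteq> W" and Z: "Z \<subseteq> W"
  shows "(\<Sum>w\<in>W. real (d w)) - (\<Sum>w\<in>X. real (d w)) - (\<Sum>w\<in>Z. real (d w))
       \<le> real (card {(a, b) \<in> arcs G. a \<notin> X \<and> b \<notin> Z})"
proof -
  \<comment> \<open>In the application \<open>X\<close> and \<open>Z\<close> are the closed
    neighbourhoods of \<open>x\<close> and \<open>y\<close> in \<open>G \<union> L\<close>, so that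
    \<open>xa\<close> and \<open>yb\<close> are neither loops nor edges of
    \<open>G \<union> L\<close>.\<close>
  let ?good = "{(a, b) \<in> arcs G. a \<notin> X \<and> b \<notin> Z}"
  let ?A = "{(a, b) \<in> arcs G. a \<in> X}" and ?B = "{(a, b) \<in> arcs G. b \<in> Z}"
  have sub: "G \<subseteq> complete_graph_on W" and deg: "\<And>w. w \<in> W \<Longrightarrow> graph_deg G w = d w"
    using G by (auto simp: graphs_avoiding_empty_iff)
  have fin: "finite (arcs G)" using finite_arcs[OF W sub] .
  have finA: "finite ?A" "finite ?B" "finite ?good"
    by (rule finite_subset[OF _ fin]; auto)+
  have S: "(\<Sum>w\<in>U. graph_deg G w) = (\<Sum>w\<in>U. d w)" if "U \<subseteq> W" for U
    using that deg by (intro sum.cong) auto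
  have "card (arcs G) \<le> card (?good \<union> (?A \<union> ?B))"
  proof (rule card_mono)
    show "finite (?good \<union> (?A \<union> ?B))" using finA by blast
  qed blast
  also have "\<dots> \<le> card ?good + (card ?A + card ?B)"
    by (meson card_Un_le add_left_mono order_trans)
  finally have "real (card (arcs G)) \<le> real (card ?good) + (real (card ?A) + real (card ?B))"
    by linarith
  then show ?thesis
    unfolding card_arcs[OF W sub] card_arcs_from[OF W sub X] card_arcs_to[OF W sub Z]
      S[OF X] S[OF Z] S[OF order_refl] of_nat_sum
    by linarith
qed

lemma alpha_nonneg:
  assumes "finite W" "W \<noteq> {}"
  shows "0 \<le> alpha W n l g h w"
  using degree_sum_nonneg[OF assms, of "max (real (g w) - real (h w)) 1"] by (simp add: alpha_def)

text \<open>A neighbour \<open>x\<close> of \<open>u\<close> has \<open>d x + l x + 1\<close>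
  vertices in its closed neighbourhood. The average of \<open>d x + l x\<close> over these
  \<open>x\<close> is at most \<open>alpha\<close>, and the shift by 2 covers \<open>x\<close>
  itself; the bound for families of sets then applies with this average.\<close>

lemma sum_nbrs_closed_nbrs_le:
  assumes W: "finite W" "L \<subseteq> complete_graph_on W" "u \<in> W"
    and G: "G \<in> graphs_avoiding W d {} L"
  shows "(\<Sum>x\<in>nbrs G u. \<Sum>a\<in>insert x (nbrs (G \<union> L) x). real (d a))
       \<le> real (d u) * degree_sum W d (alpha W d (graph_deg L) d (graph_deg {}) u + 2)"
proof (cases "d u = 0")
  \<comment> \<open>Here the maximum in \<open>alpha\<close> is 1 instead of \<open>d u\<close>, and
    \<open>alpha\<close> is no average over neighbours; but \<open>u\<close> has no neighbours and
    both sides are 0.\<close>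
  case True
  have sub: "G \<subseteq> complete_graph_on W" using G by (auto simp: graphs_avoiding_empty_iff)
  have "card (nbrs G u) = 0" using card_nbrs[OF sub, of u] G W(3) True by (auto simp: graphs_avoiding_empty_iff)
  moreover have "finite (nbrs G u)" using nbrs_subset[OF sub] W(1) finite_subset by blast
  ultimately show ?thesis using True by simp
next
  case False
  let ?\<alpha> = "alpha W d (graph_deg L) d (graph_deg {}) u"
  let ?B = "\<lambda>x. insert x (nbrs (G \<union> L) x)"
  have ne: "W \<noteq> {}" using W(3) by blast
  have sub: "G \<subseteq> complete_graph_on W" using G by (auto simp: graphs_avoiding_empty_iff)
  have sub': "G \<union> L \<subseteq> complete_graph_on W" using sub W(2) by simp
  have NW: "nbrs G u \<subseteq> W" using nbrs_subset[OF sub] .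
  have cN: "card (nbrs G u) = d u" using card_nbrs[OF sub] G W(3) by (simp add: graphs_avoiding_empty_iff)
  have "real (card (?B x)) = real (d x + graph_deg L x) + 1" if "x \<in> W" for x
  proof -
    have "finite (nbrs (G \<union> L) x)" using nbrs_subset[OF sub'] W(1) finite_subset by blast
    then show ?thesis
      using not_in_nbrs_self[OF sub', of x] card_nbrs_Un[OF W(1,2) G that] by simp
  qed
  then have "(\<Sum>x\<in>nbrs G u. real (card (?B x))) = (\<Sum>x\<in>nbrs G u. real (d x + graph_deg L x) + 1)"
    using NW by (intro sum.cong) auto
  also have "\<dots> = (\<Sum>x\<in>nbrs G u. real (d x + graph_deg L x)) + real (d u)"
    by (simp add: sum.distrib cN)
  \<comment> \<open>The neighbours form a set of \<open>d u\<close> vertices, so they carry at most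
    the \<open>d u\<close> largest values of \<open>d + l\<close>.\<close>
  also have "(\<Sum>x\<in>nbrs G u. real (d x + graph_deg L x))
      \<le> degree_sum W (\<lambda>x. d x + graph_deg L x) (max (real (d u)) 1)"
    using cN by (intro sum_le_degree_sum[OF W(1) ne NW]) simp
  also have "\<dots> = real (d u) * ?\<alpha>" using False by (simp add: alpha_def max_def)
  finally have "(\<Sum>x\<in>nbrs G u. real (card (?B x))) \<le> real (card (nbrs G u)) * (?\<alpha> + 2)"
    by (simp add: cN algebra_simps)
  moreover have "?B x \<subseteq> W" if "x \<in> nbrs G u" for x using nbrs_subset[OF sub'] NW that by blast
  moreover have "0 \<le> ?\<alpha> + 2" using alpha_nonneg[OF W(1) ne, of d "graph_deg L" d "graph_deg {}" u] by simp
  ultimately have "(\<Sum>x\<in>nbrs G u. \<Sum>a\<in>?B x. real (d a)) \<le> real (card (nbrs G u)) * degree_sum W d (?\<alpha> + 2)"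
    by (intro sum_family_le_degree_sum[OF W(1) ne]) auto
  then show ?thesis by (simp add: cN)
qed

text \<open>Double counting of the switching from \<open>ux, vy, ab\<close> to
  \<open>uv, xa, yb\<close>. A graph avoiding \<open>uv\<close> has \<open>d u * d v\<close> choices
  of \<open>x, y\<close> and then enough arcs \<open>ab\<close> on average; the result is described
  by a graph through \<open>uv\<close> and two of its arcs, with 2m(G) choices for each arc.\<close>

lemma card_through_edge_lower:
  assumes W: "finite W" "L \<subseteq> complete_graph_on W" "u \<in> W" "v \<in> W" "u \<noteq> v" "{u, v} \<notin> L"
  shows "real (card (graphs_avoiding W d {} (insert {u, v} L))) * (real (d u) * real (d v)
           * ((\<Sum>w\<in>W. real (d w)) - degree_sum W d (alpha W d (graph_deg L) d (graph_deg {}) u + 2)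
                - degree_sum W d (alpha W d (graph_deg L) d (graph_deg {}) v + 2)))
       \<le> real (card {G \<in> graphs_avoiding W d {} L. {u, v} \<in> G}) * (\<Sum>w\<in>W. real (d w))\<^sup>2"
proof -
  let ?P = "{G \<in> graphs_avoiding W d {} L. {u, v} \<in> G}"
  let ?Q = "graphs_avoiding W d {} (insert {u, v} L)"
  let ?D = "\<lambda>w. degree_sum W d (alpha W d (graph_deg L) d (graph_deg {}) w + 2)"
  let ?M = "\<Sum>w\<in>W. real (d w)"
  let ?B = "\<lambda>G x. insert x (nbrs (G \<union> L) x)"
  let ?F = "\<lambda>G x y. {(a, b) \<in> arcs G. a \<notin> ?B G x \<and> b \<notin> ?B G y}"
  let ?good = "\<lambda>G. SIGMA z:nbrs G u \<times> nbrs G v. ?F G (fst z) (snd z)"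
  let ?S = "SIGMA G:?Q. ?good G"
  let ?T = "SIGMA G:?P. arcs G \<times> arcs G"
  let ?R = "\<lambda>x y a b. {{u, x}, {v, y}, {a, b}}" and ?E = "\<lambda>x y a b. {{u, v}, {x, a}, {y, b}}"
  \<comment> \<open>The two recorded arcs \<open>xa\<close> and \<open>yb\<close> of the new graph
    reveal all four vertices.\<close>
  let ?\<phi> = "\<lambda>(G, (x, y), (a, b)). ((G - ?R x y a b) \<union> ?E x y a b, (x, a), (y, b))"
  have finP: "finite ?P" and finQ: "finite ?Q"
    using finite_graphs_avoiding[OF W(1)] by simp_all
  have sub: "G \<subseteq> complete_graph_on W" if "G \<in> graphs_avoiding W d {} L'" for G L'
    using that by (auto simp: graphs_avoiding_empty_iff)
  have QD: "G \<in> graphs_avoiding W d {} L" "{u, v} \<notin> G" if "G \<in> ?Q" for G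
    using that by (auto simp: graphs_avoiding_empty_iff)
  have farc: "finite (arcs G)" if "G \<in> graphs_avoiding W d {} L'" for G L'
    using finite_arcs[OF W(1) sub[OF that]] .
  have fF: "finite (?F G x y)" if "G \<in> ?Q" for G x y
    by (rule finite_subset[OF _ farc[OF that]]) auto
  have fN: "finite (nbrs G w)" if "G \<in> ?Q" for G w
    using nbrs_subset[OF sub[OF that]] W(1) finite_subset by blast
  have cN: "card (nbrs G w) = d w" if "G \<in> ?Q" "w \<in> W" for G w
    using card_nbrs[OF sub[OF that(1)]] that by (simp add: graphs_avoiding_empty_iff)
  have valid: "?R x y a b \<subseteq> G \<and> ?E x y a b \<subseteq> complete_graph_on W \<and> ?E x y a b \<inter> (G \<union> L) = {}
      \<and> (\<forall>w. graph_deg (?R x y a b) w = graph_deg (?E x y a b) w)"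
    if "G \<in> ?Q" "x \<in> nbrs G u" "y \<in> nbrs G v" "(a, b) \<in> ?F G x y" for G x y a b
  proof -
    have G: "G \<subseteq> complete_graph_on W" "{u, v} \<notin> G" using that(1) sub QD by auto
    have e: "{u, x} \<in> G" "{v, y} \<in> G" "{a, b} \<in> G"
      and n: "a \<noteq> x" "b \<noteq> y" "{x, a} \<notin> G \<union> L" "{y, b} \<notin> G \<union> L"
      using that(2-4) by (auto simp: arcs_def nbrs_def)
    have inW: "x \<in> W" "y \<in> W" "a \<in> W" "b \<in> W" and ne: "a \<noteq> b" "u \<noteq> x" "v \<noteq> y"
      using e G(1) edge_complete_graph_on[of u x W] edge_complete_graph_on[of v y W]
        edge_complete_graph_on[of a b W] by auto
    have "y \<noteq> u" "x \<noteq> v" "a \<noteq> u" "b \<noteq> v" "a \<noteq> y" "b \<noteq> x"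
      using e n G(2) by (auto simp: insert_commute)
    note ne = ne this
    have R: "{u, x} \<notin> {{v, y}, {a, b}}" "{v, y} \<notin> {{a, b}}"
      using ne n(1,2) W(5) by (auto simp: doubleton_eq_iff)
    have E: "{u, v} \<notin> {{x, a}, {y, b}}" "{x, a} \<notin> {{y, b}}"
      using ne n(1,2) W(5) by (auto simp: doubleton_eq_iff)
    have "graph_deg (?R x y a b) w = graph_deg (?E x y a b) w" for w
    proof -
      have "graph_deg (?R x y a b) w = of_bool (w = u) + of_bool (w = x) + (of_bool (w = v)
          + of_bool (w = y) + (of_bool (w = a) + of_bool (w = b)))"
        using R ne by (simp add: graph_deg_insert of_bool_mem_edge del: insert_iff singleton_iff)
      moreover have "graph_deg (?E x y a b) w = of_bool (w = u) + of_bool (w = v) + (of_bool (w = x)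
          + of_bool (w = a) + (of_bool (w = y) + of_bool (w = b)))"
        using E n(1,2)[symmetric] W(5)
        by (simp add: graph_deg_insert of_bool_mem_edge del: insert_iff singleton_iff)
      ultimately show ?thesis by simp
    qed
    then show ?thesis using G e n inW W by (auto simp: edge_complete_graph_on)
  qed
  have "inj_on ?\<phi> ?S"
  proof (rule inj_onI)
    fix z z' assume "z \<in> ?S" "z' \<in> ?S" and eq: "?\<phi> z = ?\<phi> z'"
    then obtain G G' x y a b where z: "z = (G, (x, y), (a, b))" "z' = (G', (x, y), (a, b))"
      and a: "G \<in> ?Q" "x \<in> nbrs G u" "y \<in> nbrs G v" "(a, b) \<in> ?F G x y"
      and b: "G' \<in> ?Q" "x \<in> nbrs G' u" "y \<in> nbrs G' v" "(a, b) \<in> ?F G' x y"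
      by (cases z, cases z') auto
    have eq: "(G - ?R x y a b) \<union> ?E x y a b = (G' - ?R x y a b) \<union> ?E x y a b" using eq z by simp
    have 1: "?R x y a b \<subseteq> G" "?E x y a b \<inter> G = {}" using valid[OF a] by auto
    have 2: "?R x y a b \<subseteq> G'" "?E x y a b \<inter> G' = {}" using valid[OF b] by auto
    show "z = z'" using switch_inject[OF eq 1(1) 2(1) 1(2) 2(2)] z by simp
  qed
  moreover have "?\<phi> ` ?S \<subseteq> ?T"
  proof (rule image_subsetI)
    fix z assume "z \<in> ?S"
    then obtain G x y a b where z: "z = (G, (x, y), (a, b))"
      and g: "G \<in> ?Q" "x \<in> nbrs G u" "y \<in> nbrs G v" "(a, b) \<in> ?F G x y" by (cases z) auto
    note v = valid[OF g]
    have "(G - ?R x y a b) \<union> ?E x y a b \<in> graphs_avoiding W d {} L"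
      using QD(1)[OF g(1)] v by (intro switch_graphs_avoiding[OF W(1)]) auto
    then show "?\<phi> z \<in> ?T" by (simp add: z arcs_def)
  qed
  moreover have "finite ?T" using finP farc by (intro finite_SigmaI finite_cartesian_product) auto
  ultimately have le: "card ?S \<le> card ?T" by (rule card_inj_on_le)
  have arcM: "real (card (arcs G)) = ?M" if "G \<in> ?P" for G
    using card_arcs[OF W(1) sub] that by (auto simp: graphs_avoiding_empty_iff)
  have "real (card ?T) = (\<Sum>G\<in>?P. real (card (arcs G)) * real (card (arcs G)))"
    using finP farc by (subst card_SigmaI) (auto simp: card_cartesian_product)
  also have "\<dots> = (\<Sum>G\<in>?P. ?M * ?M)" using arcM by (intro sum.cong) auto
  finally have T: "real (card ?T) = real (card ?P) * ?M\<^sup>2" by (simp add: power2_eq_square)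
  have good: "real (d u) * real (d v) * (?M - ?D u - ?D v) \<le> real (card (?good G))" if G: "G \<in> ?Q" for G
  proof -
    let ?s = "\<lambda>x. \<Sum>a\<in>?B G x. real (d a)"
    have BW: "?B G x \<subseteq> W" if "x \<in> W" for x using nbrs_subset[of "G \<union> L" W] sub[OF G] W(2) that by auto
    have NW: "nbrs G w \<subseteq> W" for w using nbrs_subset[OF sub[OF G]] .
    have U: "(\<Sum>x\<in>nbrs G u. ?s x) \<le> real (d u) * ?D u"
      using sum_nbrs_closed_nbrs_le[OF W(1-3) QD(1)[OF G]] .
    have V: "(\<Sum>y\<in>nbrs G v. ?s y) \<le> real (d v) * ?D v"
      using sum_nbrs_closed_nbrs_le[OF W(1,2,4) QD(1)[OF G]] .
    have "real (d u) * real (d v) * (?M - ?D u - ?D v)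
        = real (d u) * real (d v) * ?M - real (d v) * (real (d u) * ?D u) - real (d u) * (real (d v) * ?D v)"
      by (simp add: algebra_simps)
    also have "\<dots> \<le> real (d u) * real (d v) * ?M - real (d v) * (\<Sum>x\<in>nbrs G u. ?s x)
        - real (d u) * (\<Sum>y\<in>nbrs G v. ?s y)"
      using mult_left_mono[OF U, of "real (d v)"] mult_left_mono[OF V, of "real (d u)"] by linarith
    \<comment> \<open>The sum at \<open>x\<close> is repeated for each of the \<open>d v\<close>
      choices of \<open>y\<close>, and vice versa, so only the totals over the two neighbourhoods
      enter.\<close>
    also have "\<dots> = (\<Sum>x\<in>nbrs G u. \<Sum>y\<in>nbrs G v. ?M - ?s x - ?s y)"
      by (simp only: sum_subtractf sum_constant cN[OF G] W(3,4) right_diff_distrib sum_distrib_left[symmetric] mult.assoc)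
    also have "\<dots> \<le> (\<Sum>x\<in>nbrs G u. \<Sum>y\<in>nbrs G v. real (card (?F G x y)))"
      using NW BW by (intro sum_mono card_three_switch_arcs_ge[OF W(1) QD(1)[OF G]]) blast+
    also have "\<dots> = real (card (?good G))"
      using fN[OF G] fF[OF G] by (subst card_SigmaI) (auto simp: sum.cartesian_product split_beta)
    finally show ?thesis .
  qed
  have fgood: "finite (?good G)" if "G \<in> ?Q" for G
    using fN[OF that] fF[OF that] by (intro finite_SigmaI finite_cartesian_product) auto
  have "real (card ?Q) * (real (d u) * real (d v) * (?M - ?D u - ?D v))
      = (\<Sum>G\<in>?Q. real (d u) * real (d v) * (?M - ?D u - ?D v))" by simp
  also have "\<dots> \<le> (\<Sum>G\<in>?Q. real (card (?good G)))" using good by (rule sum_mono)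
  also have "\<dots> = real (card ?S)" using finQ fgood by (subst card_SigmaI) auto
  also have "\<dots> \<le> real (card ?T)" unfolding of_nat_le_iff by (rule le)
  finally show ?thesis unfolding T .
qed

section \<open>Forbidding one more edge\<close>

lemma card_graphs_avoiding_split:
  assumes "finite W"
  shows "card (graphs_avoiding W d {} L)
       = card (graphs_avoiding W d {} (insert e L)) + card {G \<in> graphs_avoiding W d {} L. e \<in> G}"
proof -
  have "graphs_avoiding W d {} L
      = graphs_avoiding W d {} (insert e L) \<union> {G \<in> graphs_avoiding W d {} L. e \<in> G}"
    by (auto simp: graphs_avoiding_empty_iff)
  moreover have "graphs_avoiding W d {} (insert e L) \<inter> {G \<in> graphs_avoiding W d {} L. e \<in> G} = {}"
    by (auto simp: graphs_avoiding_empty_iff)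
  ultimately show ?thesis
    using card_Un_disjoint[of "graphs_avoiding W d {} (insert e L)" "{G \<in> graphs_avoiding W d {} L. e \<in> G}"]
      finite_graphs_avoiding[OF assms] by simp
qed

text \<open>All degrees on \<open>W\<close> are then 0. This settles the degenerate case of (B),
  where division by zero makes \<open>f_bound\<close> equal to 1 and no graph may pass through the
  edge.\<close>

lemma no_graph_through_edge:
  assumes "finite W" "u \<in> W" "(\<Sum>w\<in>W. real (d w)) = 0"
  shows "{G \<in> graphs_avoiding W d {} L. {u, v} \<in> G} = {}"
proof (rule ccontr)
  assume "\<not> ?thesis"
  then obtain G where G: "G \<in> graphs_avoiding W d {} L" "{u, v} \<in> G" by auto
  then have sub: "G \<subseteq> complete_graph_on W" by (auto simp: graphs_avoiding_empty_iff)
  have "d u = 0" using assms by (simp add: sum_nonneg_eq_0_iff)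
  then have "card (nbrs G u) = 0" using card_nbrs[OF sub, of u] G(1) assms(2) by (simp add: graphs_avoiding_empty_iff)
  moreover have "finite (nbrs G u)" using nbrs_subset[OF sub] assms(1) finite_subset by blast
  ultimately show False using G(2) by (auto simp: nbrs_def)
qed

text \<open>With \<open>n\<close> graphs avoiding \<open>uv\<close>, \<open>s\<close> through it and
  \<open>g\<close> for \<open>g_bound\<close>, the left side is
  \<open>n * g + n * (t / M) * g\<close>. The first term is at most \<open>n\<close> because
  \<open>g \<le> 1\<close>; the second is at most \<open>s\<close> by the three-edge
  switching.\<close>

lemma card_avoiding_edge_upper:
  assumes W: "finite W" "L \<subseteq> complete_graph_on W" "u \<in> W" "v \<in> W" "u \<noteq> v" "{u, v} \<notin> L"
  shows "real (card (graphs_avoiding W d {} (insert {u, v} L)))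
           * (1 + real (d u) * real (d v) / (2 * edge_count W d)) * g_bound W d {} L u v
       \<le> real (card (graphs_avoiding W d {} L))"
proof -
  define M where "M = (\<Sum>w\<in>W. real (d w))"
  define D where "D = (\<lambda>w. degree_sum W d (alpha W d (graph_deg L) d (graph_deg {}) w + 2))"
  define n where "n = real (card (graphs_avoiding W d {} (insert {u, v} L)))"
  define s where "s = real (card {G \<in> graphs_avoiding W d {} L. {u, v} \<in> G})"
  define t where "t = real (d u) * real (d v)"
  have ne: "W \<noteq> {}" using W(3) by blast
  have D0: "0 \<le> D w" for w
    unfolding D_def using degree_sum_nonneg[OF W(1) ne] alpha_nonneg[OF W(1) ne] by simp
  have M0: "0 \<le> M" "0 \<le> n" "0 \<le> s" unfolding M_def n_def s_def by (simp_all add: sum_nonneg)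
  have g: "g_bound W d {} L u v = 1 - (D u + D v) / M"
    by (simp add: g_bound_def residual_degree_sum_def edge_count_def D_def M_def)
  have m: "2 * edge_count W d = M" by (simp add: edge_count_def M_def)
  have tot: "real (card (graphs_avoiding W d {} L)) = n + s"
    unfolding n_def s_def using card_graphs_avoiding_split[OF W(1)] by (metis of_nat_add)
  have main: "n * (t * (M - D u - D v)) \<le> s * M\<^sup>2"
    using card_through_edge_lower[OF W, of d] by (simp add: n_def s_def t_def M_def D_def)
  have "n * (1 + t / M) * (1 - (D u + D v) / M) \<le> n + s"
  proof (cases "M = 0")
    case False
    with M0 have pos: "M > 0" by simp
    have "n * (t / M * (1 - (D u + D v) / M)) = n * (t * (M - D u - D v)) / M\<^sup>2"
      using pos by (simp add: field_simps power2_eq_square)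
    also have "\<dots> \<le> s" using main pos by (simp add: divide_le_eq)
    finally have "n * (t / M * (1 - (D u + D v) / M)) \<le> s" .
    moreover have "n * (1 - (D u + D v) / M) \<le> n"
      using M0 D0 pos by (intro mult_left_le) auto
    ultimately show ?thesis by (simp only: distrib_left distrib_right mult_1_right mult.assoc)
  \<comment> \<open>For \<open>M = 0\<close> both quotients are 0 and the claim reads
    \<open>n \<le> n + s\<close>.\<close>
  qed (use M0 in simp)
  then show ?thesis unfolding tot g m n_def[symmetric] t_def[symmetric] .
qed

text \<open>Splitting \<open>(n + s) * f\<close>, with \<open>f\<close> for \<open>f_bound\<close>,
  the part \<open>n * f\<close> is at most \<open>n\<close> because \<open>f \<le> 1\<close>, and
  \<open>s * f\<close> is at most \<open>n * t / M\<close> by the two-edge switching.\<close>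

lemma card_avoiding_edge_lower:
  assumes W: "finite W" "L \<subseteq> complete_graph_on W" "u \<in> W" "v \<in> W" "u \<noteq> v" "{u, v} \<notin> L"
  shows "real (card (graphs_avoiding W d {} L)) * f_bound W d {} L u v
       \<le> real (card (graphs_avoiding W d {} (insert {u, v} L)))
           * (1 + real (d u) * real (d v) / (2 * edge_count W d))"
proof -
  define M where "M = (\<Sum>w\<in>W. real (d w))"
  define D where "D = (\<lambda>w. degree_sum W d (real (d w) + real (graph_deg L w)))"
  define n where "n = real (card (graphs_avoiding W d {} (insert {u, v} L)))"
  define s where "s = real (card {G \<in> graphs_avoiding W d {} L. {u, v} \<in> G})"
  define t where "t = real (d u) * real (d v)"
  have ne: "W \<noteq> {}" using W(3) by blast
  have D0: "0 \<le> D w" for w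
    unfolding D_def using degree_sum_nonneg[OF W(1) ne] by simp
  have M0: "0 \<le> M" "0 \<le> n" "0 \<le> s" unfolding M_def n_def s_def by (simp_all add: sum_nonneg)
  have f: "f_bound W d {} L u v = 1 - (D u + D v) / M"
    by (simp add: f_bound_def residual_degree_sum_def edge_count_def D_def M_def)
  have m: "2 * edge_count W d = M" by (simp add: edge_count_def M_def)
  have tot: "real (card (graphs_avoiding W d {} L)) = n + s"
    unfolding n_def s_def using card_graphs_avoiding_split[OF W(1)] by (metis of_nat_add)
  have main: "s * (M - D u - D v) \<le> n * t"
    using card_through_edge_upper[OF W, of d] by (simp add: n_def s_def t_def M_def D_def)
  have "(n + s) * (1 - (D u + D v) / M) \<le> n * (1 + t / M)"
  proof (cases "M = 0")
    case True
    then have "s = 0" unfolding s_def M_def by (simp only: no_graph_through_edge[OF W(1,3)] card.empty of_nat_0)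
    then show ?thesis using True by simp
  next
    case False
    with M0 have pos: "M > 0" by simp
    have "s * (1 - (D u + D v) / M) = s * (M - D u - D v) / M"
      using pos by (simp add: field_simps)
    also have "\<dots> \<le> n * t / M" using main pos by (intro divide_right_mono) auto
    finally have "s * (1 - (D u + D v) / M) \<le> n * (t / M)" by simp
    moreover have "n * (1 - (D u + D v) / M) \<le> n"
      using M0 D0 pos by (intro mult_left_le) auto
    ultimately show ?thesis by (simp only: distrib_left distrib_right mult_1_right)
  qed
  then show ?thesis unfolding tot f m n_def[symmetric] t_def[symmetric] .
qed

section \<open>Telescoping over the edges of \<open>Y\<close>\<close>

theorem mainTheorem4:
  fixes W :: "'a set" and d :: "'a \<Rightarrow> nat" and L0 Y :: "'a set set"
    and p q :: "nat \<Rightarrow> 'a" and L :: "nat \<Rightarrow> 'a set set"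
  assumes "finite W"
    and "L0 \<subseteq> complete_graph_on W" and "Y \<subseteq> complete_graph_on W" and "L0 \<inter> Y = {}"
    and "graphs_avoiding W d {} L0 \<noteq> {}"
    and "bij_betw (\<lambda>j. {p j, q j}) {1..card Y} Y"
    and "\<And>j. L j = L0 \<union> (\<lambda>i. {p i, q i}) ` {1..j}"
  shows "((\<forall>j\<in>{1..card Y}. g_bound W d {} (L (j - 1)) (p j) (q j) > 0) \<longrightarrow>
          measure_pmf.prob (pmf_of_set (graphs_avoiding W d {} L0)) {G. Y \<inter> G = {}}
            \<le> (\<Prod>j=1..card Y. inverse (1 + real (d (p j)) * real (d (q j)) / (2 * edge_count W d)))
              * (\<Prod>j=1..card Y. 1 / g_bound W d {} (L (j - 1)) (p j) (q j)))
       \<and> ((\<forall>j\<in>{1..card Y}. f_bound W d {} (L (j - 1)) (p j) (q j) > 0) \<longrightarrow>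
          measure_pmf.prob (pmf_of_set (graphs_avoiding W d {} L0)) {G. Y \<inter> G = {}}
            \<ge> (\<Prod>j=1..card Y. inverse (1 + real (d (p j)) * real (d (q j)) / (2 * edge_count W d)))
              * (\<Prod>j=1..card Y. f_bound W d {} (L (j - 1)) (p j) (q j)))"
proof -
  let ?S = "\<lambda>j. graphs_avoiding W d {} (L j)"
  let ?a = "\<lambda>j. 1 + real (d (p j)) * real (d (q j)) / (2 * edge_count W d)"
  let ?g = "\<lambda>j. g_bound W d {} (L (j - 1)) (p j) (q j)"
  let ?f = "\<lambda>j. f_bound W d {} (L (j - 1)) (p j) (q j)"
  let ?m = "card Y"
  let ?prob = "measure_pmf.prob (pmf_of_set (graphs_avoiding W d {} L0)) {G. Y \<inter> G = {}}"
  have inj: "inj_on (\<lambda>j. {p j, q j}) {1..?m}" and img: "(\<lambda>j. {p j, q j}) ` {1..?m} = Y"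
    using assms(6) by (auto simp: bij_betw_def)
  have L_0: "L 0 = L0" and L_m: "L ?m = L0 \<union> Y" using assms(7) img by simp_all
  have L_Suc: "L (Suc j) = insert {p (Suc j), q (Suc j)} (L j)" for j
    by (simp add: assms(7) atLeastAtMostSuc_conv)
  have step: "L j \<subseteq> complete_graph_on W \<and> p (Suc j) \<in> W \<and> q (Suc j) \<in> W \<and> p (Suc j) \<noteq> q (Suc j)
      \<and> {p (Suc j), q (Suc j)} \<notin> L j" if "Suc j \<le> ?m" for j
  proof -
    have Y: "{p i, q i} \<in> Y" if "i \<in> {1..Suc j}" for i using img that \<open>Suc j \<le> ?m\<close> by auto
    \<comment> \<open>The enumeration is injective, so the next edge is not among the earlier
      ones.\<close>
    have "{p (Suc j), q (Suc j)} \<notin> (\<lambda>i. {p i, q i}) ` {1..j}"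
      using inj_on_image_mem_iff[OF inj, of "Suc j" "{1..j}"] that by simp
    moreover have "{p (Suc j), q (Suc j)} \<notin> L0" using Y[of "Suc j"] assms(4) by auto
    moreover have "L j \<subseteq> complete_graph_on W" using assms(2,3) Y by (auto simp: assms(7))
    moreover have "{p (Suc j), q (Suc j)} \<in> complete_graph_on W" using Y[of "Suc j"] assms(3) by auto
    ultimately show ?thesis by (simp add: assms(7) edge_complete_graph_on)
  qed
  have n0: "real (card (?S 0)) > 0"
    using assms(5) finite_graphs_avoiding[OF assms(1)] by (simp add: L_0 card_gt_0_iff)
  \<comment> \<open>Avoiding \<open>L0\<close> and \<open>Y\<close> means avoiding
    \<open>L ?m\<close>, so the probability is the ratio of the last to the first of the counts
    compared step by step below.\<close>
  have "graphs_avoiding W d {} L0 \<inter> {G. Y \<inter> G = {}} = ?S ?m"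
    by (auto simp: L_m graphs_avoiding_empty_iff)
  then have prob: "?prob = real (card (?S ?m)) / real (card (?S 0))"
    using measure_pmf_of_set[OF assms(5) finite_graphs_avoiding[OF assms(1)]] by (simp add: L_0)
  \<comment> \<open>If \<open>edge_count W d\<close> is 0, the quotient is 0 by convention and
    \<open>?a j\<close> is 1.\<close>
  have a_pos: "?a j > 0" for j
    by (intro add_pos_nonneg divide_nonneg_nonneg) (auto simp: edge_count_def sum_nonneg)
  \<comment> \<open>Induction on the number of forbidden edges. \<open>?g i\<close> refers to
    \<open>L (i - 1)\<close>, so the passage from \<open>j\<close> to \<open>Suc j\<close> uses
    \<open>L j\<close>; positivity of \<open>?g\<close> permits the division.\<close>
  have upper: "real (card (?S j)) \<le> real (card (?S 0)) * ((\<Prod>i=1..j. inverse (?a i)) * (\<Prod>i=1..j. 1 / ?g i))"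
    if g: "\<forall>i\<in>{1..?m}. ?g i > 0" and "j \<le> ?m" for j
    using that(2)
  proof (induction j)
    case (Suc j)
    have gpos: "?g (Suc j) > 0" using bspec[OF g, of "Suc j"] Suc.prems by simp
    have "real (card (?S (Suc j))) * ?a (Suc j) * ?g (Suc j) \<le> real (card (?S j))"
      using card_avoiding_edge_upper[OF assms(1), of "L j" "p (Suc j)" "q (Suc j)" d] step[OF Suc.prems] L_Suc[of j]
      by simp
    then have "real (card (?S (Suc j))) \<le> real (card (?S j)) * (inverse (?a (Suc j)) * (1 / ?g (Suc j)))"
      using gpos a_pos[of "Suc j"] by (simp add: divide_simps mult.assoc)
    also have "\<dots> \<le> (real (card (?S 0)) * ((\<Prod>i=1..j. inverse (?a i)) * (\<Prod>i=1..j. 1 / ?g i)))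
        * (inverse (?a (Suc j)) * (1 / ?g (Suc j)))"
      using Suc gpos a_pos[of "Suc j"] by (intro mult_right_mono) auto
    finally show ?case by (simp only: prod.nat_ivl_Suc' le_add1 plus_1_eq_Suc mult_ac)
  qed simp
  have lower: "real (card (?S 0)) * ((\<Prod>i=1..j. inverse (?a i)) * (\<Prod>i=1..j. ?f i)) \<le> real (card (?S j))"
    if f: "\<forall>i\<in>{1..?m}. ?f i > 0" and "j \<le> ?m" for j
    using that(2)
  proof (induction j)
    case (Suc j)
    have fpos: "?f (Suc j) > 0" using bspec[OF f, of "Suc j"] Suc.prems by simp
    have "real (card (?S j)) * ?f (Suc j) \<le> real (card (?S (Suc j))) * ?a (Suc j)"
      using card_avoiding_edge_lower[OF assms(1), of "L j" "p (Suc j)" "q (Suc j)" d] step[OF Suc.prems] L_Suc[of j]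
      by simp
    then have "real (card (?S j)) * (inverse (?a (Suc j)) * ?f (Suc j)) \<le> real (card (?S (Suc j)))"
      using a_pos[of "Suc j"] by (simp add: divide_simps mult.assoc)
    \<comment> \<open>Positivity of \<open>?f\<close> allows the induction hypothesis to be
      multiplied by the new factor.\<close>
    moreover have "(real (card (?S 0)) * ((\<Prod>i=1..j. inverse (?a i)) * (\<Prod>i=1..j. ?f i)))
        * (inverse (?a (Suc j)) * ?f (Suc j)) \<le> real (card (?S j)) * (inverse (?a (Suc j)) * ?f (Suc j))"
      using Suc fpos a_pos[of "Suc j"] by (intro mult_right_mono) auto
    ultimately have "(real (card (?S 0)) * ((\<Prod>i=1..j. inverse (?a i)) * (\<Prod>i=1..j. ?f i)))
        * (inverse (?a (Suc j)) * ?f (Suc j)) \<le> real (card (?S (Suc j)))" by (rule order_trans[rotated])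
    then show ?case by (simp only: prod.nat_ivl_Suc' le_add1 plus_1_eq_Suc mult_ac)
  qed simp
  show ?thesis
  proof (intro conjI impI)
    assume "\<forall>j\<in>{1..?m}. ?g j > 0"
    from upper[OF this order_refl] n0
    show "?prob \<le> (\<Prod>j=1..?m. inverse (?a j)) * (\<Prod>j=1..?m. 1 / ?g j)"
      unfolding prob by (simp only: pos_divide_le_eq mult.commute)
  next
    assume "\<forall>j\<in>{1..?m}. ?f j > 0"
    from lower[OF this order_refl] n0
    show "?prob \<ge> (\<Prod>j=1..?m. inverse (?a j)) * (\<Prod>j=1..?m. ?f j)"
      unfolding prob by (simp only: pos_le_divide_eq mult.commute)
  qed
qed

end
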